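(* Let $\mathcal{I}$ be an index coding (IC) problem over a finite field $\mathbb{F}_q$ with $L\times K$ fitting matrix $F_X$, and let $G$ be an $r\times K$ index code for $\mathcal{I}$. Let $m$ be a positive integer and let $F_{ext,X}$ be the $mL\times mK$ fitting matrix whose rows are divided into $m$ consecutive blocks of size $L$ and whose columns are divided into $m$ consecutive blocks of size $K$, such that for $i,j\in\{1,\dots,m\}$ the $(i,j)$-th $L\times K$ block of $F_{ext,X}$ equals $F_X$ if $i=j$ and equals $F_X^X$ if $i\neq j$, where $F_X^X$ is the matrix obtained from $F_X$ by replacing every $1$ by $X$. Let $\mathcal{I}_{ext}$ be the IC problem with fitting matrix $F_{ext,X}$ (an $m$-order extension of $\mathcal{I}$). Then the $r\times mK$ matrix $$G_{ext}=(\underbrace{G\,|\,G\,|\cdots|\,G}_{m\text{ times}})$$ is an index code for $\mathcal{I}_{ext}$. Furthermore, if $G$ is optimal for $\mathcal{I}$, then $G_{ext}$ is optimal for $\mathcal{I}_{ext}$. Thus $\mathcal{I}_{ext}$ is a rank-invariant extension of $\mathcal{I}$, i.e. $minrk(F_{ext,X})=minrk(F_X)$.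
   Context: Fix a finite field $\mathbb{F}_q$. A fitting matrix $F_X$ of size $L\times K$ ($L\ge K$) is a matrix with entries in the symbol set $\{0,1,X\}$ such that each row contains exactly one $1$ (its other entries being $0$s and $X$s), and for every column $k$ there is at least one row having its $1$ in position $k$. It defines an IC problem with $K$ messages, with symbols $x_1,\dots,x_K\in\mathbb{F}_q$, and $L$ receivers, one per row: the receiver of a row demands the message $k$ where the row has its $1$, and has as side-information exactly the message symbols at the positions where the row has an $X$. A (scalar linear) index code of length $r$ for the problem is an $r\times K$ matrix $G$ over $\mathbb{F}_q$ such that, when $G\boldsymbol{x}$ is broadcast for $\boldsymbol{x}=(x_1,\dots,x_K)^T\in\mathbb{F}_q^K$, every receiver can recover its demanded symbol from $G\boldsymbol{x}$ and its side-information symbols (for all $\boldsymbol{x}$). The code is optimal if its length $r$ is the minimum possible among all such codes for the problem. $minrk(F_X)$ is the minimum rank over $\mathbb{F}_q$ of the matrices obtained from $F_X$ by replacing each $X$ by an arbitrary element of $\mathbb{F}_q$ (independently for each position; the $0$s and $1$s are kept). It is a known fact that the optimal length of a scalar linear index code equals $minrk(F_X)$. An IC problem $\mathcal{I}_{ext}$ with fitting matrix $F_{ext,X}$ is an extension of $\mathcal{I}$ (with $L\times K$ fitting matrix $F_X$) if $F_X$ is a submatrix of $F_{ext,X}$; it is an $m$-order extension if $F_{ext,X}$ is $mL\times mK$. The extension is rank-invariant if the optimal code lengths are equal, i.e. $minrk(F_{ext,X})=minrk(F_X)$. *)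

theory Defs
  imports
    "Jordan_Normal_Form.DL_Rank"
    "Jordan_Normal_Form.DL_Submatrix"
    "HOL-Library.FuncSet"
begin

datatype symbol = S0 | S1 | SX

definition fitting_matrix :: "symbol mat \<Rightarrow> bool" where
  "fitting_matrix F \<longleftrightarrow>
     dim_col F \<le> dim_row F \<and>
     (\<forall>i < dim_row F. \<exists>!k. k < dim_col F \<and> F $$ (i, k) = S1) \<and>
     (\<forall>k < dim_col F. \<exists>i < dim_row F. F $$ (i, k) = S1)"

definition side_info :: "symbol mat \<Rightarrow> nat \<Rightarrow> nat set" where
  "side_info F i = {j. j < dim_col F \<and> F $$ (i, j) = SX}"

text \<open>Receiver \<open>i\<close> demands message \<open>k\<close> iff \<open>F $$ (i, k) = S1\<close>. Its decoder \<open>D\<close> may be an arbitrary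
  function, but it sees only the broadcast \<open>G x\<close> and the restriction of the message vector to the
  side-information positions.\<close>

definition index_code :: "symbol mat \<Rightarrow> 'a::field mat \<Rightarrow> bool" where
  "index_code F G \<longleftrightarrow>
     dim_col G = dim_col F \<and>
     (\<forall>i < dim_row F. \<forall>k < dim_col F. F $$ (i, k) = S1 \<longrightarrow>
        (\<exists>D :: 'a vec \<Rightarrow> (nat \<Rightarrow> 'a) \<Rightarrow> 'a. \<forall>x \<in> carrier_vec (dim_col F).
           D (G *\<^sub>v x) (restrict (\<lambda>j. x $ j) (side_info F i)) = x $ k))"

definition optimal_index_code :: "symbol mat \<Rightarrow> 'a::field mat \<Rightarrow> bool" where
  "optimal_index_code F G \<longleftrightarrow>
     index_code F G \<and> (\<forall>G' :: 'a mat. index_code F G' \<longrightarrow> dim_row G \<le> dim_row G')"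

text \<open>In the next definitions the field is passed as a type argument, since it cannot be
  determined from \<open>F\<close>.\<close>

definition optimal_length :: "'a::field itself \<Rightarrow> symbol mat \<Rightarrow> nat" where
  "optimal_length _ F = (LEAST r. \<exists>G :: 'a mat. index_code F G \<and> dim_row G = r)"

definition completions :: "symbol mat \<Rightarrow> 'a::field mat set" where
  "completions F = {A \<in> carrier_mat (dim_row F) (dim_col F).
     \<forall>i < dim_row F. \<forall>j < dim_col F.
       (F $$ (i, j) = S0 \<longrightarrow> A $$ (i, j) = 0) \<and> (F $$ (i, j) = S1 \<longrightarrow> A $$ (i, j) = 1)}"

definition minrk :: "'a::field itself \<Rightarrow> symbol mat \<Rightarrow> nat" where
  "minrk _ F = (LEAST r. \<exists>A :: 'a mat. A \<in> completions F \<and> vec_space.rank (dim_row F) A = r)"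

definition is_extension :: "symbol mat \<Rightarrow> symbol mat \<Rightarrow> bool" where
  "is_extension F F' \<longleftrightarrow>
     fitting_matrix F \<and> fitting_matrix F' \<and> (\<exists>I J. submatrix F' I J = F)"

definition is_order_extension :: "nat \<Rightarrow> symbol mat \<Rightarrow> symbol mat \<Rightarrow> bool" where
  "is_order_extension m F F' \<longleftrightarrow>
     is_extension F F' \<and> F' \<in> carrier_mat (m * dim_row F) (m * dim_col F)"

definition rank_invariant_extension :: "'a::field itself \<Rightarrow> symbol mat \<Rightarrow> symbol mat \<Rightarrow> bool" where
  "rank_invariant_extension T F F' \<longleftrightarrow>
     is_extension F F' \<and> optimal_length T F' = optimal_length T F"

definition one_to_X :: "symbol mat \<Rightarrow> symbol mat" where
  "one_to_X F = map_mat (\<lambda>s. if s = S1 then SX else s) F"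

text \<open>With 0-based indices, row \<open>i\<close> lies in row block \<open>i div dim_row F\<close> at offset
  \<open>i mod dim_row F\<close>; likewise for columns.\<close>

definition F_ext :: "nat \<Rightarrow> symbol mat \<Rightarrow> symbol mat" where
  "F_ext m F = mat (m * dim_row F) (m * dim_col F) (\<lambda>(i, j).
     (if i div dim_row F = j div dim_col F then F else one_to_X F)
       $$ (i mod dim_row F, j mod dim_col F))"

definition G_ext :: "nat \<Rightarrow> 'a mat \<Rightarrow> 'a mat" where
  "G_ext m G = mat (dim_row G) (m * dim_col G) (\<lambda>(i, j). G $$ (i, j mod dim_col G))"

end

(* Summing the m message blocks reduces the extended problem to the original one: G_ext x = G y for
   y the sum of the blocks, and every side-information symbol of y is available because the symbol
   X occupies the same offset in all blocks.  Decoding y at the demanded offset and subtracting the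
   other m - 1 blocks (which the off-diagonal X's reveal) gives the demanded symbol.  Conversely, a
   code for the extension restricts to the first block of messages.  For minrk, a completion of F
   repeated in all blocks completes F_ext with the same rank, and the first block of a completion
   of F_ext completes F. *)

theory Submission
  imports Defs
begin

subsection \<open>Rank under reindexing\<close>

text \<open>Each column of the reindexed matrix is the image of a column of \<open>A\<close> under
  the linear map that reads a vector along \<open>f\<close>. A linear map injective on a set carries
  a dependence of that set to one of its image, so independent columns lift to independent columns
  of \<open>A\<close>. As \<open>f\<close> and \<open>g\<close> may repeat or omit indices, this
  covers both copying a block and cutting one out.\<close>

lemma rank_reindex_le:
  fixes A :: "'a::field mat"
  assumes A: "A \<in> carrier_mat n nc"
    and f: "\<And>i. i < n' \<Longrightarrow> f i < n" and g: "\<And>j. j < nc' \<Longrightarrow> g j < nc"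
  shows "vec_space.rank n' (mat n' nc' (\<lambda>(i, j). A $$ (f i, g j))) \<le> vec_space.rank n A"
proof -
  interpret V: vec_space "TYPE('a)" n .
  interpret W: vec_space "TYPE('a)" n' .
  define B where "B = mat n' nc' (\<lambda>(i, j). A $$ (f i, g j))"
  have B: "B \<in> carrier_mat n' nc'" by (simp add: B_def)
  \<comment> \<open>The empty set is the seed that is enlarged to a maximal independent set
    \<open>S\<close> of columns, whose cardinality is the rank.\<close>
  have "W.lin_indpt {}" by (simp add: W.lin_dep_def)
  then obtain S where S: "maximal S (\<lambda>T. T \<subseteq> set (cols B) \<and> W.lin_indpt T)"
    using maximal_exists_superset[of "set (cols B)" "\<lambda>T. T \<subseteq> set (cols B) \<and> W.lin_indpt T" "{}"]
    by blast
  have SB: "S \<subseteq> set (cols B)" and Si: "W.lin_indpt S" using S by (auto simp: maximal_def)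
  have Sc: "S \<subseteq> carrier_vec n'" using SB B cols_dim by blast
  define h where "h u = vec n' (\<lambda>i. u $ f i)" for u :: "'a vec"
  have "S \<subseteq> h ` set (cols A)"
  proof
    fix v assume "v \<in> S"
    then obtain j where j: "j < nc'" "v = col B j"
      using SB B by (metis carrier_matD(2) cols_length cols_nth in_set_conv_nth subsetD)
    have "v = h (col A (g j))"
      using j A f g by (auto simp: B_def h_def)
    moreover have "col A (g j) \<in> set (cols A)"
      using g[OF j(1)] A by (metis carrier_matD(2) cols_length cols_nth nth_mem)
    ultimately show "v \<in> h ` set (cols A)" by blast
  qed
  \<comment> \<open>One preimage is chosen for each element of \<open>S\<close>, so that
    \<open>h\<close> is injective on \<open>U\<close> and \<open>card U = card S\<close>.\<close>
  then obtain U where U: "U \<subseteq> set (cols A)" "inj_on h U" "S = h ` U"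
    by (metis subset_image_inj)
  have fU: "finite U" using U(1) finite_subset by blast
  have Uc: "U \<subseteq> carrier_vec n" using U(1) A cols_dim by blast
  have "V.lin_indpt U"
  proof
    assume "V.lin_dep U"
    then obtain a w where a: "V.lincomb a U = 0\<^sub>v n" "w \<in> U" "a w \<noteq> 0"
      using V.finite_lin_dep[OF fU] Uc by auto
    \<comment> \<open>The coefficients of the dependence are carried along the bijection
      \<open>h\<close> from \<open>U\<close> to \<open>S\<close>. Entry \<open>i\<close> of the new
      combination is then entry \<open>f i\<close> of the old one, which is zero.\<close>
    define c where "c = a \<circ> the_inv_into U h"
    have ch: "c (h u) = a u" if "u \<in> U" for u
      using that U(2) by (simp add: c_def the_inv_into_f_f)
    have "W.lincomb c S = 0\<^sub>v n'"
    proof (rule eq_vecI)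
      show "dim_vec (W.lincomb c S) = dim_vec (0\<^sub>v n')"
        using W.lincomb_dim[of S c] fU U(3) Sc by simp
      fix i assume "i < dim_vec (0\<^sub>v n' :: 'a vec)"
      then have i: "i < n'" by simp
      have "W.lincomb c S $ i = (\<Sum>v\<in>S. c v * v $ i)"
        by (rule W.lincomb_index[OF i Sc])
      also have "\<dots> = (\<Sum>u\<in>U. a u * u $ f i)"
        unfolding U(3) sum.reindex[OF U(2)] using i by (auto intro!: sum.cong simp: ch[unfolded h_def] h_def)
      also have "\<dots> = V.lincomb a U $ f i"
        by (rule V.lincomb_index[OF f[OF i] Uc, symmetric])
      finally show "W.lincomb c S $ i = 0\<^sub>v n' $ i" using a(1) f[OF i] i by simp
    qed
    moreover have "c (h w) \<noteq> 0" "h w \<in> S" using ch a U(3) by auto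
    ultimately have "W.lin_dep S"
      using W.lin_dep_crit[of S S "h w" c] fU U(3) Sc by auto
    with Si show False by simp
  qed
  then have "card U \<le> V.rank A" using V.rank_ge_card_indpt[OF A U(1)] by simp
  moreover have "W.rank B = card S" by (rule W.rank_card_indpt[OF B S])
  ultimately show ?thesis using U by (simp add: B_def card_image)
qed

subsection \<open>The extended fitting matrix\<close>

lemma block_index_less:
  fixes b j m n :: nat
  assumes "b < m" "j < n"
  shows "b * n + j < m * n"
proof -
  have "b * n + j < Suc b * n" using assms by simp
  also have "\<dots> \<le> m * n" using assms by (intro mult_le_mono1) simp
  finally show ?thesis .
qed

lemma block_index_bounds:
  fixes i m n :: nat
  assumes "i < m * n"
  shows "i div n < m" "i mod n < n"
  using assms by (auto simp: less_mult_imp_div_less intro!: mod_less_divisor gr0I)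

lemma dim_F_ext [simp]:
  "dim_row (F_ext m F) = m * dim_row F" "dim_col (F_ext m F) = m * dim_col F"
  by (simp_all add: F_ext_def)

text \<open>Merges the two kinds of block into one formula: they differ only where \<open>F\<close>
  has a \<open>S1\<close>, so the positions of \<open>S0\<close> and \<open>SX\<close> in
  \<open>F\<close> keep their symbols in every block.\<close>

lemma F_ext_index:
  assumes "i < m * dim_row F" "j < m * dim_col F"
  shows "F_ext m F $$ (i, j) =
    (if F $$ (i mod dim_row F, j mod dim_col F) = S1 \<and> i div dim_row F \<noteq> j div dim_col F then SX
     else F $$ (i mod dim_row F, j mod dim_col F))"
  using assms block_index_bounds[OF assms(1)] block_index_bounds[OF assms(2)]
  by (auto simp: F_ext_def one_to_X_def)

lemma F_ext_eq_S1_iff: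
  assumes "i < m * dim_row F" "j < m * dim_col F"
  shows "F_ext m F $$ (i, j) = S1 \<longleftrightarrow>
    i div dim_row F = j div dim_col F \<and> F $$ (i mod dim_row F, j mod dim_col F) = S1"
  by (auto simp: F_ext_index[OF assms])

lemma F_ext_first_block:
  assumes "m > 0" "i < dim_row F" "j < dim_col F"
  shows "F_ext m F $$ (i, j) = F $$ (i, j)"
proof -
  have "i < m * dim_row F" "j < m * dim_col F"
    using assms block_index_less[of 0 m] by auto
  then show ?thesis using assms by (simp add: F_ext_index)
qed

lemma fitting_matrix_F_ext:
  assumes "fitting_matrix F"
  shows "fitting_matrix (F_ext m F)"
  unfolding fitting_matrix_def dim_F_ext
proof (intro conjI allI impI)
  show "m * dim_col F \<le> m * dim_row F"
    using assms by (simp add: fitting_matrix_def)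
next
  fix i assume i: "i < m * dim_row F"
  note ib = block_index_bounds[OF i]
  obtain k where k: "k < dim_col F" "F $$ (i mod dim_row F, k) = S1"
    and uniq: "\<And>k'. k' < dim_col F \<Longrightarrow> F $$ (i mod dim_row F, k') = S1 \<Longrightarrow> k' = k"
    using assms ib(2) unfolding fitting_matrix_def by metis
  show "\<exists>!k. k < m * dim_col F \<and> F_ext m F $$ (i, k) = S1"
  \<comment> \<open>Ones survive only in diagonal blocks, so the demanded column has the block
    number of row \<open>i\<close> and the offset \<open>k\<close> demanded in
    \<open>F\<close>.\<close>
  proof (rule ex1I[of _ "i div dim_row F * dim_col F + k"])
    have l: "i div dim_row F * dim_col F + k < m * dim_col F"
      using block_index_less ib(1) k(1) by blast
    then show "i div dim_row F * dim_col F + k < m * dim_col F \<and>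
      F_ext m F $$ (i, i div dim_row F * dim_col F + k) = S1"
      using k by (simp add: F_ext_eq_S1_iff[OF i l])
  next
    fix k' assume k': "k' < m * dim_col F \<and> F_ext m F $$ (i, k') = S1"
    then have "i div dim_row F = k' div dim_col F" "k' mod dim_col F = k"
      using F_ext_eq_S1_iff[OF i] uniq block_index_bounds(2)[of k'] by auto
    then show "k' = i div dim_row F * dim_col F + k"
      by (metis div_mult_mod_eq)
  qed
next
  fix k assume k: "k < m * dim_col F"
  note kb = block_index_bounds[OF k]
  obtain i where i: "i < dim_row F" "F $$ (i, k mod dim_col F) = S1"
    using assms kb(2) unfolding fitting_matrix_def by metis
  have l: "k div dim_col F * dim_row F + i < m * dim_row F"
    using block_index_less kb(1) i(1) by blast
  show "\<exists>i<m * dim_row F. F_ext m F $$ (i, k) = S1"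
    using i l by (intro exI[of _ "k div dim_col F * dim_row F + i"])
      (simp add: F_ext_eq_S1_iff[OF l k])
qed

lemma submatrix_F_ext:
  assumes "m > 0"
  shows "submatrix (F_ext m F) {..<dim_row F} {..<dim_col F} = F"
proof -
  \<comment> \<open>On an initial segment the enumeration \<open>pick\<close> is the identity, so
    the chosen submatrix is read at unchanged indices.\<close>
  have pick: "pick {..<n} i = i" if "i < n" for i n
  proof -
    have "{a \<in> {..<n}. a < i} = {..<i}" using that by auto
    then show ?thesis using pick_card_in_set[of i "{..<n}"] that by simp
  qed
  have le: "n \<le> m * n" for n using assms by simp
  have "{i. i < m * n \<and> i \<in> {..<n}} = {..<n}" for n
    by (auto intro: order.strict_trans2[OF _ le])
  then have d: "card {i. i < m * n \<and> i \<in> {..<n}} = n" for n by simp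
  show ?thesis
    unfolding submatrix_def dim_F_ext d
    by (rule eq_matI) (auto simp: pick F_ext_first_block assms)
qed

lemma is_extension_F_ext:
  assumes "fitting_matrix F" "m > 0"
  shows "is_extension F (F_ext m F)"
  unfolding is_extension_def using assms fitting_matrix_F_ext submatrix_F_ext by blast

subsection \<open>Codes\<close>

lemma sum_blocks:
  fixes f :: "nat \<Rightarrow> 'b::comm_monoid_add"
  shows "(\<Sum>t<m * n. f t) = (\<Sum>b<m. \<Sum>j<n. f (b * n + j))"
proof -
  have "sum f {b * n..<b * n + n} = (\<Sum>j<n. f (b * n + j))" for b
    using sum.shift_bounds_nat_ivl[of f 0 "b * n" n] by (simp add: lessThan_atLeast0 add.commute)
  then show ?thesis by (simp flip: sum.nat_group)
qed

text \<open>Columns of \<open>G_ext m G\<close> with the same offset coincide, so messages with the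
  same offset share a coefficient and can be added first.\<close>

lemma G_ext_mult_vec:
  fixes G :: "'a::field mat"
  assumes x: "x \<in> carrier_vec (m * dim_col G)"
  shows "G_ext m G *\<^sub>v x = G *\<^sub>v vec (dim_col G) (\<lambda>j. \<Sum>b<m. x $ (b * dim_col G + j))"
    (is "_ = G *\<^sub>v ?y")
proof (rule eq_vecI)
  let ?K = "dim_col G"
  fix i assume "i < dim_vec (G *\<^sub>v ?y)"
  then have i: "i < dim_row G" by simp
  have "(G_ext m G *\<^sub>v x) $ i = (\<Sum>t<m * ?K. G $$ (i, t mod ?K) * x $ t)"
    using i x by (auto simp: G_ext_def scalar_prod_def lessThan_atLeast0 intro!: sum.cong)
  also have "\<dots> = (\<Sum>b<m. \<Sum>j<?K. G $$ (i, j) * x $ (b * ?K + j))"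
    unfolding sum_blocks by (auto intro!: sum.cong)
  also have "\<dots> = (\<Sum>j<?K. G $$ (i, j) * (\<Sum>b<m. x $ (b * ?K + j)))"
    by (subst sum.swap) (simp add: sum_distrib_left)
  also have "\<dots> = (G *\<^sub>v ?y) $ i"
    using i by (auto simp: scalar_prod_def lessThan_atLeast0 intro!: sum.cong)
  finally show "(G_ext m G *\<^sub>v x) $ i = (G *\<^sub>v ?y) $ i" .
qed (simp add: G_ext_def)

lemma index_code_G_ext:
  fixes G :: "'a::field mat"
  assumes code: "index_code F G"
  shows "index_code (F_ext m F) (G_ext m G)"
  unfolding index_code_def dim_F_ext
proof (intro conjI allI impI)
  have dG: "dim_col G = dim_col F" using code by (simp add: index_code_def)
  show "dim_col (G_ext m G) = m * dim_col F" by (simp add: G_ext_def dG)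
  let ?K = "dim_col F"
  fix i k assume i: "i < m * dim_row F" and k: "k < m * ?K" and one: "F_ext m F $$ (i, k) = S1"
  define i' k' b0 where "i' = i mod dim_row F" and "k' = k mod ?K" and "b0 = k div ?K"
  have ib: "i div dim_row F = b0" and one': "F $$ (i', k') = S1"
    using one unfolding F_ext_eq_S1_iff[OF i k] i'_def k'_def b0_def by auto
  have i': "i' < dim_row F" and k': "k' < ?K" and b0: "b0 < m"
    using block_index_bounds[OF i] block_index_bounds[OF k] by (auto simp: i'_def k'_def b0_def)
  have k_eq: "k = b0 * ?K + k'" by (simp add: k'_def b0_def)
  obtain D where D: "\<And>y. y \<in> carrier_vec ?K \<Longrightarrow>
      D (G *\<^sub>v y) (restrict (\<lambda>j. y $ j) (side_info F i')) = y $ k'"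
    using code i' k' one' unfolding index_code_def by metis
  \<comment> \<open>An \<open>SX\<close> of \<open>F\<close> stays \<open>SX\<close> in diagonal and
    off-diagonal blocks alike, so all summands of a side-information entry of \<open>y\<close> are
    known.\<close>
  have side1: "b * ?K + j \<in> side_info (F_ext m F) i" if "b < m" "j \<in> side_info F i'" for b j
  proof -
    have j: "j < ?K" "F $$ (i', j) = SX" using that by (auto simp: side_info_def)
    then show ?thesis
      using block_index_less[OF that(1) j(1)] F_ext_index[OF i]
      by (simp add: side_info_def i'_def[symmetric])
  qed
  \<comment> \<open>Outside block \<open>b0\<close> the demanded \<open>S1\<close> has turned into
    \<open>SX\<close>, which reveals the other messages at offset \<open>k'\<close>.\<close>
  have side2: "b * ?K + k' \<in> side_info (F_ext m F) i" if "b < m" "b \<noteq> b0" for b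
    using block_index_less[OF that(1) k'] F_ext_index[OF i] one' that(2) k' ib
    by (simp add: side_info_def i'_def[symmetric])
  \<comment> \<open>The first term decodes the block sum at offset \<open>k'\<close>; the second
    removes the contributions of the blocks other than \<open>b0\<close>. By \<open>side1\<close>
    and \<open>side2\<close>, \<open>s\<close> is read only where the receiver knows it.\<close>
  define E where "E w s =
      D w (restrict (\<lambda>j. \<Sum>b<m. s (b * ?K + j)) (side_info F i')) - (\<Sum>b\<in>{..<m} - {b0}. s (b * ?K + k'))"
    for w :: "'a vec" and s :: "nat \<Rightarrow> 'a"
  have "E (G_ext m G *\<^sub>v x) (restrict (\<lambda>j. x $ j) (side_info (F_ext m F) i)) = x $ k"
    if x: "x \<in> carrier_vec (m * ?K)" for x
  proof -
    define s where "s = restrict (\<lambda>j. x $ j) (side_info (F_ext m F) i)"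
    define y where "y = vec ?K (\<lambda>j. \<Sum>b<m. x $ (b * ?K + j))"
    have Gy: "G_ext m G *\<^sub>v x = G *\<^sub>v y"
      using G_ext_mult_vec[of x m G] x unfolding y_def dG by simp
    have r: "restrict (\<lambda>j. \<Sum>b<m. s (b * ?K + j)) (side_info F i') =
        restrict (\<lambda>j. y $ j) (side_info F i')"
    proof (rule restrict_ext)
      fix j assume j: "j \<in> side_info F i'"
      then show "(\<Sum>b<m. s (b * ?K + j)) = y $ j"
        using side1 by (auto simp: s_def y_def side_info_def intro!: sum.cong)
    qed
    have "E (G_ext m G *\<^sub>v x) s = y $ k' - (\<Sum>b\<in>{..<m} - {b0}. s (b * ?K + k'))"
      unfolding E_def Gy r by (subst D) (simp_all add: y_def)
    also have "(\<Sum>b\<in>{..<m} - {b0}. s (b * ?K + k')) = (\<Sum>b\<in>{..<m} - {b0}. x $ (b * ?K + k'))"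
      using side2 by (auto simp: s_def intro!: sum.cong)
    also have "y $ k' - \<dots> = x $ k"
      using k' b0 by (simp add: y_def k_eq sum.remove[of "{..<m}" b0])
    finally show ?thesis unfolding s_def .
  qed
  then show "\<exists>D. \<forall>x\<in>carrier_vec (m * ?K).
      D (G_ext m G *\<^sub>v x) (restrict (\<lambda>j. x $ j) (side_info (F_ext m F) i)) = x $ k"
    by blast
qed

text \<open>Fixing all messages outside the first block to zero turns \<open>G'\<close> into its
  first \<open>dim_col F\<close> columns, and the receivers of the first row block then act as those
  of \<open>F\<close>.\<close>

lemma index_code_F_ext_restrict:
  fixes G' :: "'a::field mat"
  assumes code: "index_code (F_ext m F) G'" and m: "m > 0"
  shows "index_code F (mat (dim_row G') (dim_col F) (\<lambda>(i, j). G' $$ (i, j)))" (is "index_code F ?G")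
  unfolding index_code_def
proof (intro conjI allI impI)
  show "dim_col ?G = dim_col F" by simp
  let ?K = "dim_col F"
  have dG: "dim_col G' = m * ?K" using code by (simp add: index_code_def)
  have le: "n \<le> m * n" for n using m by simp
  fix i k assume i: "i < dim_row F" and k: "k < ?K" and one: "F $$ (i, k) = S1"
  have i': "i < m * dim_row F" and k': "k < m * ?K" using i k le order.strict_trans2 by blast+
  have "F_ext m F $$ (i, k) = S1" using F_ext_first_block[OF m i k] one by simp
  then obtain D where D: "\<And>z. z \<in> carrier_vec (m * ?K) \<Longrightarrow>
      D (G' *\<^sub>v z) (restrict (\<lambda>j. z $ j) (side_info (F_ext m F) i)) = z $ k"
    using code i' k' unfolding index_code_def dim_F_ext by metis
  \<comment> \<open>The decoder \<open>D\<close> also expects side information from later blocks; it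
    is fed the agreed value 0 there.\<close>
  define E where "E w s = D w (restrict (\<lambda>j. if j < ?K then s j else 0) (side_info (F_ext m F) i))"
    for w :: "'a vec" and s :: "nat \<Rightarrow> 'a"
  have "E (?G *\<^sub>v x) (restrict (\<lambda>j. x $ j) (side_info F i)) = x $ k"
    if x: "x \<in> carrier_vec ?K" for x
  proof -
    define z where "z = vec (m * ?K) (\<lambda>j. if j < ?K then x $ j else 0)"
    have G: "?G *\<^sub>v x = G' *\<^sub>v z"
    proof (rule eq_vecI)
      fix a assume "a < dim_vec (G' *\<^sub>v z)"
      then have a: "a < dim_row G'" by simp
      have "(G' *\<^sub>v z) $ a = (\<Sum>j<m * ?K. G' $$ (a, j) * (if j < ?K then x $ j else 0))"
        using a dG by (auto simp: z_def scalar_prod_def lessThan_atLeast0 intro!: sum.cong)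
      also have "\<dots> = (\<Sum>j<?K. G' $$ (a, j) * x $ j)"
        using le[of ?K] by (intro sum.mono_neutral_cong_right) auto
      also have "\<dots> = (?G *\<^sub>v x) $ a"
        using a x by (auto simp: scalar_prod_def lessThan_atLeast0 intro!: sum.cong)
      finally show "(?G *\<^sub>v x) $ a = (G' *\<^sub>v z) $ a" by simp
    qed simp
    have r: "restrict (\<lambda>j. if j < ?K then restrict (\<lambda>j. x $ j) (side_info F i) j else 0)
          (side_info (F_ext m F) i) = restrict (\<lambda>j. z $ j) (side_info (F_ext m F) i)"
    proof (rule restrict_ext)
      fix j assume j: "j \<in> side_info (F_ext m F) i"
      \<comment> \<open>The first diagonal block is \<open>F\<close> itself, so within it
        \<open>D\<close> asks only for symbols that the receiver of \<open>F\<close> has.\<close>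
      then have "j \<in> side_info F i" if "j < ?K"
        using that F_ext_first_block[OF m i that] by (simp add: side_info_def)
      then show "(if j < ?K then restrict (\<lambda>j. x $ j) (side_info F i) j else 0) = z $ j"
        using j by (auto simp: z_def side_info_def)
    qed
    show ?thesis
      unfolding E_def r G using D[of z] k k' by (simp add: z_def)
  qed
  then show "\<exists>D. \<forall>x\<in>carrier_vec ?K.
      D (?G *\<^sub>v x) (restrict (\<lambda>j. x $ j) (side_info F i)) = x $ k"
    by blast
qed

lemma optimal_index_code_G_ext:
  fixes G :: "'a::field mat"
  assumes opt: "optimal_index_code F G" and m: "m > 0"
  shows "optimal_index_code (F_ext m F) (G_ext m G)"
  unfolding optimal_index_code_def
proof (intro conjI allI impI)
  show "index_code (F_ext m F) (G_ext m G)"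
    using opt index_code_G_ext by (auto simp: optimal_index_code_def)
next
  fix G' :: "'a mat"
  assume "index_code (F_ext m F) G'"
  from opt index_code_F_ext_restrict[OF this m] show "dim_row (G_ext m G) \<le> dim_row G'"
    by (force simp: optimal_index_code_def G_ext_def)
qed

text \<open>Repeating \<open>G\<close> and truncating \<open>G'\<close> both preserve the number of
  rows, so the two problems admit codes of exactly the same lengths.\<close>

lemma optimal_length_F_ext:
  assumes "m > 0"
  shows "optimal_length TYPE('a::field) (F_ext m F) = optimal_length TYPE('a) F"
proof -
  have "(\<exists>G :: 'a mat. index_code (F_ext m F) G \<and> dim_row G = r) \<longleftrightarrow>
      (\<exists>G :: 'a mat. index_code F G \<and> dim_row G = r)" for r
  proof
    assume "\<exists>G :: 'a mat. index_code (F_ext m F) G \<and> dim_row G = r"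
    then show "\<exists>G :: 'a mat. index_code F G \<and> dim_row G = r"
      using index_code_F_ext_restrict[OF _ assms] dim_row_mat(1) by blast
  next
    assume "\<exists>G :: 'a mat. index_code F G \<and> dim_row G = r"
    then obtain G :: "'a mat" where "index_code F G" "dim_row G = r" by blast
    then show "\<exists>G :: 'a mat. index_code (F_ext m F) G \<and> dim_row G = r"
      using index_code_G_ext[of F G m] by (intro exI[of _ "G_ext m G"]) (simp add: G_ext_def)
  qed
  then show ?thesis by (simp add: optimal_length_def)
qed

subsection \<open>Minimum rank\<close>

lemma minrk_le_rank:
  fixes A :: "'a::field mat"
  assumes "A \<in> completions F"
  shows "minrk TYPE('a) F \<le> vec_space.rank (dim_row F) A"
  unfolding minrk_def using assms by (intro Least_le) blast

lemma minrk_attained: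
  obtains A :: "'a::field mat" where "A \<in> completions F"
    "vec_space.rank (dim_row F) A = minrk TYPE('a) F"
proof -
  \<comment> \<open>Filling every \<open>SX\<close> with 0 gives a completion, so the least rank is
    taken over a nonempty set and is attained.\<close>
  have "mat (dim_row F) (dim_col F) (\<lambda>p. if F $$ p = S1 then 1 else 0) \<in> (completions F :: 'a mat set)"
    by (simp add: completions_def)
  then have "\<exists>r. \<exists>A :: 'a mat. A \<in> completions F \<and> vec_space.rank (dim_row F) A = r"
    by blast
  from LeastI_ex[OF this] show ?thesis using that unfolding minrk_def by blast
qed

lemma minrk_F_ext:
  assumes m: "m > 0"
  shows "minrk TYPE('a::field) (F_ext m F) = minrk TYPE('a) F"
proof (rule antisym)
  let ?L = "dim_row F" and ?K = "dim_col F"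
  obtain A :: "'a mat" where A: "A \<in> completions F"
    and rk: "vec_space.rank ?L A = minrk TYPE('a) F"
    by (rule minrk_attained)
  have A_dim: "A \<in> carrier_mat ?L ?K" using A by (simp add: completions_def)
  let ?A = "mat (m * ?L) (m * ?K) (\<lambda>(i, j). A $$ (i mod ?L, j mod ?K))"
  \<comment> \<open>In an off-diagonal block the repeated \<open>A\<close> has a 1 where
    \<open>F\<close> has \<open>S1\<close>; the symbol there is \<open>SX\<close>, which allows any
    value.\<close>
  have "?A \<in> completions (F_ext m F)"
    using A by (auto simp: completions_def F_ext_index dest!: block_index_bounds(2) split: if_splits)
  then have "minrk TYPE('a) (F_ext m F) \<le> vec_space.rank (m * ?L) ?A"
    using minrk_le_rank by fastforce
  also have "\<dots> \<le> vec_space.rank ?L A"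
    by (rule rank_reindex_le[OF A_dim]) (auto dest: block_index_bounds(2))
  finally show "minrk TYPE('a) (F_ext m F) \<le> minrk TYPE('a) F" using rk by simp
next
  let ?L = "dim_row F" and ?K = "dim_col F"
  obtain A :: "'a mat" where A: "A \<in> completions (F_ext m F)"
    and rk: "vec_space.rank (m * ?L) A = minrk TYPE('a) (F_ext m F)"
    using minrk_attained[of "F_ext m F"] by auto
  have A_dim: "A \<in> carrier_mat (m * ?L) (m * ?K)" using A by (simp add: completions_def)
  have le: "i < m * n" if "i < n" for i n :: nat
    using block_index_less[of 0 m i n] that m by simp
  \<comment> \<open>This is the top left block, where \<open>F_ext m F\<close> agrees with
    \<open>F\<close>; its rank is bounded by reindexing along the identity.\<close>
  let ?A = "mat ?L ?K (\<lambda>(i, j). A $$ (i, j))"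
  have "?A \<in> completions F"
    using A by (auto simp: completions_def le F_ext_first_block[OF m])
  then have "minrk TYPE('a) F \<le> vec_space.rank ?L ?A" by (rule minrk_le_rank)
  also have "\<dots> \<le> vec_space.rank (m * ?L) A"
    by (rule rank_reindex_le[OF A_dim]) (auto intro: le)
  finally show "minrk TYPE('a) F \<le> minrk TYPE('a) (F_ext m F)" using rk by simp
qed

theorem theorem1:
  fixes F :: "symbol mat" and G :: "'a::{field,finite} mat" and L K r m :: nat
  assumes "F \<in> carrier_mat L K" and "fitting_matrix F"
    and "G \<in> carrier_mat r K" and "index_code F G"
    and "m > 0"
  shows "is_order_extension m F (F_ext m F)
    \<and> G_ext m G \<in> carrier_mat r (m * K)
    \<and> index_code (F_ext m F) (G_ext m G)
    \<and> (optimal_index_code F G \<longrightarrow> optimal_index_code (F_ext m F) (G_ext m G))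
    \<and> rank_invariant_extension TYPE('a) F (F_ext m F)
    \<and> minrk TYPE('a) (F_ext m F) = minrk TYPE('a) F"
proof (intro conjI impI)
  show "is_order_extension m F (F_ext m F)"
    unfolding is_order_extension_def
    by (intro conjI is_extension_F_ext carrier_matI dim_F_ext assms(2,5))
  show "G_ext m G \<in> carrier_mat r (m * K)"
    using assms(3) by (simp add: G_ext_def)
  show "index_code (F_ext m F) (G_ext m G)"
    by (rule index_code_G_ext[OF assms(4)])
  show "optimal_index_code (F_ext m F) (G_ext m G)" if "optimal_index_code F G"
    by (rule optimal_index_code_G_ext[OF that assms(5)])
  show "rank_invariant_extension TYPE('a) F (F_ext m F)"
    unfolding rank_invariant_extension_def
    by (intro conjI is_extension_F_ext optimal_length_F_ext assms)
  show "minrk TYPE('a) (F_ext m F) = minrk TYPE('a) F"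
    by (rule minrk_F_ext[OF assms(5)])
qed

end
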